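(* Let $B(x)=\sum_{k\ge 1}b_k\frac{x^k}{k!}$ and $C(x)=\sum_{k\ge 1}c_k\frac{x^k}{k!}$ be the formal power series $$B(x)=\Big(x\Big(\frac{e^x-1-x}{x^2/2}\Big)^{1/2}\Big)^{\langle -1\rangle},\qquad C(x)=\Big(x\Big(\frac{-\log(1+x)+x}{x^2/2}\Big)^{1/2}\Big)^{\langle -1\rangle},$$ and put $\tilde b_k=b_k/k!$, $\tilde c_k=c_k/k!$. Then $b_1=c_1=\tilde b_1=\tilde c_1=1$ and, for every integer $k\ge 2$, $$b_k=-\frac{1}{k+1}\left(\binom{k}{2}b_{k-1}+\sum_{j=1}^{k-2}\binom{k}{j}b_{j+1}b_{k-j}\right),$$ $$\tilde b_k=-\frac{1}{k+1}\left(\frac{k-1}{2}\,\tilde b_{k-1}+\sum_{j=1}^{k-2}(j+1)\,\tilde b_{j+1}\tilde b_{k-j}\right),$$ $$c_k=\frac{1}{k+1}\left(k\,c_{k-1}-\sum_{j=1}^{k-2}\binom{k}{j}c_{j+1}c_{k-j}\right),$$ $$\tilde c_k=\frac{1}{k+1}\left(\tilde c_{k-1}-\sum_{j=1}^{k-2}(j+1)\,\tilde c_{j+1}\tilde c_{k-j}\right).$$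
   Context: For a formal power series $R(x)=xT(x)$ with $T$ a formal power series with nonzero constant term, $R^{\langle -1\rangle}$ denotes its substitutional (compositional) inverse, i.e. $S=R^{\langle -1\rangle}$ means $R(S(x))=S(R(x))=x$. The series $\frac{e^x-1-x}{x^2/2}$ and $\frac{-\log(1+x)+x}{x^2/2}$ have constant term $1$, and the power $1/2$ denotes their formal square root with constant term $1$. Empty sums (when $k=2$) are $0$. *)

theory Defs
  imports "HOL-Computational_Algebra.Formal_Power_Series"
begin

unbundle fps_syntax

text \<open>
  The square root with constant term 1 of a power series with constant term 1. The first argument
  of \<^const>\<open>fps_radical\<close> only prescribes the constant term of the root.
\<close>

definition fps_sqrt1 :: "'a::field_char_0 fps \<Rightarrow> 'a fps" where
  "fps_sqrt1 f = fps_radical (\<lambda>_ _. 1) 2 f"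

lemma fps_sqrt1_nth_0 [simp]: "fps_sqrt1 f $ 0 = 1"
  by (simp add: fps_sqrt1_def)

lemma fps_sqrt1_power2: "f $ 0 = 1 \<Longrightarrow> fps_sqrt1 f ^ 2 = f"
  using power_radical[of f "\<lambda>_ _. 1" 1] by (simp add: fps_sqrt1_def numeral_2_eq_2)

lemma fps_sqrt1_unique:
  assumes "g ^ 2 = f" "g $ 0 = 1"
  shows "g = fps_sqrt1 f"
proof -
  have "f $ 0 = 1"
    using assms by (auto simp: power2_eq_square)
  with assms show ?thesis
    using radical_unique[of "\<lambda>_ _. 1" 1 f g] by (simp add: fps_sqrt1_def numeral_2_eq_2)
qed

text \<open>
  \<^term>\<open>fps_exp 1\<close> is $e^x$ and \<^term>\<open>fps_ln 1\<close> is $\log(1+x)$. Both numerators are divisible by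
  $x^2$, so the divisions below are exact (proved next).
\<close>

definition B_base :: "'a::field_char_0 fps" where
  "B_base = (fps_exp 1 - 1 - fps_X) / (fps_X ^ 2 / 2)"

definition C_base :: "'a::field_char_0 fps" where
  "C_base = (- fps_ln 1 + fps_X) / (fps_X ^ 2 / 2)"

definition B_series :: "'a::field_char_0 fps" where
  "B_series = fps_inv (fps_X * fps_sqrt1 B_base)"

definition C_series :: "'a::field_char_0 fps" where
  "C_series = fps_inv (fps_X * fps_sqrt1 C_base)"

lemma fps_half: "fps_X ^ 2 / 2 = fps_const (1 / 2 :: 'a::field_char_0) * fps_X ^ 2"
proof -
  have "fps_X ^ 2 / 2 = fps_X ^ 2 / fps_const (2 :: 'a)"
    by (simp add: numeral_fps_const)
  also have "\<dots> = fps_const (1 / 2) * fps_X ^ 2"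
    by (subst fps_divide_unit) (simp_all add: fps_const_inverse inverse_eq_divide mult.commute)
  finally show ?thesis .
qed

lemma exact_division_half_square:
  fixes f :: "'a::field_char_0 fps"
  assumes "f $ 0 = 0" "f $ 1 = 0"
  shows "f / (fps_X ^ 2 / 2) * (fps_X ^ 2 / 2) = f"
    and "(f / (fps_X ^ 2 / 2)) $ 0 = 2 * f $ 2"
proof -
  have f: "f = (fps_const 2 * fps_shift 2 f) * (fps_X ^ 2 / 2)"
  proof (rule fps_ext)
    fix n
    have "(fps_const 2 * fps_shift 2 f) * (fps_X ^ 2 / 2) =
        (fps_const 2 * fps_const (1 / 2)) * (fps_shift 2 f * fps_X ^ 2)"
      by (simp only: fps_half mult_ac)
    also have "\<dots> = fps_shift 2 f * fps_X ^ 2"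
      by simp
    also have "\<dots> $ n = f $ n"
      using assms le_add_diff_inverse2[of 2 n]
      by (cases "n < 2") (auto simp: fps_X_power_mult_right_nth less_2_cases_iff)
    finally show "f $ n = ((fps_const 2 * fps_shift 2 f) * (fps_X ^ 2 / 2)) $ n"
      by simp
  qed
  have nz: "fps_X ^ 2 / 2 \<noteq> (0 :: 'a fps)"
    by (simp add: fps_half)
  have q: "f / (fps_X ^ 2 / 2) = fps_const 2 * fps_shift 2 f"
    using nz by (subst f) (rule nonzero_mult_div_cancel_right)
  show "f / (fps_X ^ 2 / 2) * (fps_X ^ 2 / 2) = f"
    unfolding q by (rule f [symmetric])
  show "(f / (fps_X ^ 2 / 2)) $ 0 = 2 * f $ 2"
    unfolding q by (simp add: numeral_2_eq_2)
qed

lemma B_base_nth_0: "B_base $ 0 = 1"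
  and B_base_mult: "B_base * (fps_X ^ 2 / 2) = fps_exp 1 - 1 - fps_X"
  unfolding B_base_def
  by (subst exact_division_half_square; simp add: fact_numeral)+

lemma C_base_nth_0: "C_base $ 0 = 1"
  and C_base_mult: "C_base * (fps_X ^ 2 / 2) = - fps_ln 1 + fps_X"
  unfolding C_base_def
  by (subst exact_division_half_square; simp add: fps_ln_nth)+

lemma B_series_inverse:
  "(fps_X * fps_sqrt1 B_base) oo B_series = fps_X"
  "B_series oo (fps_X * fps_sqrt1 B_base) = fps_X"
  unfolding B_series_def by (rule fps_inv_right fps_inv; simp)+

lemma C_series_inverse:
  "(fps_X * fps_sqrt1 C_base) oo C_series = fps_X"
  "C_series oo (fps_X * fps_sqrt1 C_base) = fps_X"
  unfolding C_series_def by (rule fps_inv_right fps_inv; simp)+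

text \<open>
  The series $\sum_{k\ge 1} a_k x^k/k!$. The value \<open>a 0\<close> is ignored.
\<close>

definition egf1 :: "(nat \<Rightarrow> 'a::field_char_0) \<Rightarrow> 'a fps" where
  "egf1 a = Abs_fps (\<lambda>k. if k = 0 then 0 else a k / fact k)"

lemma egf1_expansion:
  "f $ 0 = 0 \<Longrightarrow> f = egf1 a \<longleftrightarrow> (\<forall>k\<ge>1. a k = fact k * f $ k)"
  by (auto simp: egf1_def fps_eq_iff field_simps)

lemma B_series_nth_0: "B_series $ 0 = 0"
  and C_series_nth_0: "C_series $ 0 = 0"
  by (simp_all add: B_series_def C_series_def fps_inv_def)

end

theory Submission
  imports Defs
begin

text \<open>
  The recurrences are coefficient comparisons in first-order differential equations.
  Squaring the defining relations of the compositional inverses removes the square roots and gives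
  \[ e^B - 1 - B = x^2/2, \qquad C - \log(1+C) = x^2/2 \]
  (lemma \<open>compose_of_half_square_root\<close>). Differentiating, and eliminating $e^B$ by means of the
  undifferentiated equation for $B$ and the denominator $1+C$ by multiplication, yields
  \[ B B' + \tfrac{x^2}{2} B' = x, \qquad C C' = x (1 + C) \]
  (lemmas \<open>B_series_ode\<close> and \<open>C_series_ode\<close>). In the coefficient of $x^k$ in $f f'$, for
  $f = x + \dots$, the two extreme terms together contribute $(k+1) f_k$
  (lemma \<open>mult_deriv_nth\<close>), and solving for $f_k$ gives the recurrences for $\tilde b_k$ and
  $\tilde c_k$. Those for $b_k$ and $c_k$ follow by multiplying with $k!$.
\<close>

text \<open>
  The series \<open>q\<close> stands for \<open>g / (fps_X ^ 2 / 2)\<close>, so the hypothesis \<open>inv\<close> says that \<open>f\<close> is a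
  compositional right inverse of $\sqrt{2g}$; squaring it leaves an equation for $g$ alone.
\<close>

lemma compose_of_half_square_root:
  fixes f g q :: "'a::field_char_0 fps"
  assumes inv: "(fps_X * fps_sqrt1 q) oo f = fps_X"
    and f0: "f $ 0 = 0" and q0: "q $ 0 = 1" and g: "q * (fps_X ^ 2 / 2) = g"
  shows "g oo f = fps_const (1 / 2) * fps_X ^ 2"
proof -
  have "g = fps_const (1 / 2) * (fps_X * fps_sqrt1 q) ^ 2"
    by (simp add: g [symmetric] fps_half power_mult_distrib fps_sqrt1_power2 q0 mult_ac)
  then have "g oo f = fps_const (1 / 2) * ((fps_X * fps_sqrt1 q) oo f) ^ 2"
    by (simp only: fps_compose_mult_distrib [OF f0, of "fps_const _"] fps_const_compose
        fps_compose_power [OF f0, symmetric])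
  then show ?thesis
    by (simp add: inv)
qed

lemma deriv_compose_of_half_square:
  fixes f g :: "'a::field_char_0 fps"
  assumes "g oo f = fps_const (1 / 2) * fps_X ^ 2" and "f $ 0 = 0"
  shows "(fps_deriv g oo f) * fps_deriv f = fps_X"
proof -
  have "(fps_deriv g oo f) * fps_deriv f = fps_deriv (fps_const (1 / 2) * fps_X ^ 2)"
    using fps_compose_deriv [OF assms(2), of g] assms(1) by simp
  also have "\<dots> = fps_X"
    by (rule fps_ext) (simp only: fps_deriv_nth fps_mult_left_const_nth fps_X_power_nth fps_X_nth, auto)
  finally show ?thesis .
qed

lemma fps_inv_X_mult_nth_1:
  fixes s :: "'a::field_char_0 fps"
  assumes "s $ 0 = 1"
  shows "fps_inv (fps_X * s) $ 1 = 1"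
  using assms by (simp add: fps_inv_def)

lemma B_series_nth_1: "B_series $ 1 = 1"
  and C_series_nth_1: "C_series $ 1 = 1"
  unfolding B_series_def C_series_def by (rule fps_inv_X_mult_nth_1, simp)+

lemma B_series_ode:
  "B_series * fps_deriv B_series + fps_const (1 / 2) * fps_X ^ 2 * fps_deriv B_series
    = (fps_X :: 'a::field_char_0 fps)"
proof -
  let ?B = "B_series :: 'a fps"
  have B: "(fps_exp 1 - 1 - fps_X) oo ?B = fps_const (1 / 2) * fps_X ^ 2"
    by (rule compose_of_half_square_root
        [OF B_series_inverse(1) B_series_nth_0 B_base_nth_0 B_base_mult])
  have "((fps_exp 1 - 1) oo ?B) * fps_deriv ?B = fps_X"
    using deriv_compose_of_half_square [OF B B_series_nth_0] by simp
  moreover have "(fps_exp 1 - 1) oo ?B = ?B + fps_const (1 / 2) * fps_X ^ 2"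
    using B by (simp add: fps_compose_sub_distrib fps_compose_add_distrib B_series_nth_0 algebra_simps)
  ultimately show ?thesis
    by (simp add: algebra_simps)
qed

lemma C_series_ode:
  "C_series * fps_deriv C_series = fps_X * (1 + C_series :: 'a::field_char_0 fps)"
proof -
  let ?C = "C_series :: 'a fps"
  have C: "(- fps_ln 1 + fps_X) oo ?C = fps_const (1 / 2) * fps_X ^ 2"
    by (rule compose_of_half_square_root
        [OF C_series_inverse(1) C_series_nth_0 C_base_nth_0 C_base_mult])
  \<comment> \<open>The derivative $x/(1+x)$ of $x - \log(1+x)$, with the denominator cleared before composing.\<close>
  have "fps_deriv (fps_ln 1) * (1 + fps_X) = (1 :: 'a fps)"
    by (simp add: fps_ln_deriv inverse_mult_eq_1)
  then have "fps_deriv (- fps_ln 1 + fps_X) * (1 + fps_X) = (fps_X :: 'a fps)"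
    by (simp add: algebra_simps)
  then have "(fps_deriv (- fps_ln 1 + fps_X) * (1 + fps_X)) oo ?C = ?C"
    by (simp add: C_series_nth_0)
  then have "(fps_deriv (- fps_ln 1 + fps_X) oo ?C) * (1 + ?C) = ?C"
    by (simp only: fps_compose_mult_distrib [OF C_series_nth_0] fps_compose_add_distrib
        fps_compose_1 fps_X_fps_compose_startby0 [OF C_series_nth_0])
  then have "?C * fps_deriv ?C
      = (fps_deriv (- fps_ln 1 + fps_X) oo ?C) * fps_deriv ?C * (1 + ?C)"
    by (metis mult.assoc mult.commute)
  then show ?thesis
    by (simp only: deriv_compose_of_half_square [OF C C_series_nth_0])
qed

text \<open>
  In the Cauchy product the top coefficient of \<open>f\<close> occurs twice, as $f_k f'_0 = f_k$ and as
  $f_1 f'_{k-1} = k f_k$; all other nonzero terms involve only $f_2, \dots, f_{k-1}$.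
\<close>

lemma mult_deriv_nth:
  fixes f :: "'a::field_char_0 fps"
  assumes "f $ 0 = 0" and "f $ 1 = 1" and "k \<ge> 2"
  shows "(f * fps_deriv f) $ k
    = (of_nat k + 1) * f $ k + (\<Sum>j = 1..k - 2. (of_nat j + 1) * f $ (j + 1) * f $ (k - j))"
proof -
  have notin: "0 \<notin> insert (k - 1) (insert k {1..k - 2})" "k - 1 \<notin> insert k {1..k - 2}"
    "k \<notin> {1..k - 2}"
    using assms(3) by auto
  define t where "t j = (of_nat j + 1) * f $ (j + 1) * f $ (k - j)" for j
  have "(f * fps_deriv f) $ k = (fps_deriv f * f) $ k"
    by (simp add: mult.commute)
  also have "\<dots> = (\<Sum>j = 0..k. t j)"
    by (simp add: fps_mult_nth t_def add.commute)
  also have "{0..k} = insert 0 (insert (k - 1) (insert k {1..k - 2}))"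
    using assms(3) by auto
  also have "(\<Sum>j\<in>\<dots>. t j) = t 0 + (t (k - 1) + (t k + (\<Sum>j = 1..k - 2. t j)))"
    by (simp only: sum.insert notin finite_insert finite_atLeastAtMost not_False_eq_True)
  also have "t 0 = f $ k"
    using assms(2) by (simp add: t_def)
  also have "t (k - 1) = of_nat k * f $ k"
    using assms(2,3) by (simp add: t_def of_nat_diff)
  also have "t k = 0"
    using assms(1) by (simp add: t_def)
  finally show ?thesis
    by (simp add: t_def algebra_simps)
qed

lemma B_series_nth_rec:
  fixes k :: nat
  defines "u \<equiv> \<lambda>k. (B_series :: 'a::field_char_0 fps) $ k"
  assumes "k \<ge> 2"
  shows "u k = - (1 / (of_nat k + 1)) * ((of_nat k - 1) / 2 * u (k - 1)
    + (\<Sum>j = 1..k - 2. (of_nat j + 1) * u (j + 1) * u (k - j)))"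
proof -
  have nz: "of_nat k + 1 \<noteq> (0 :: 'a)"
    by (metis of_nat_Suc of_nat_neq_0 add.commute)
  have idx: "k - Suc 0 = Suc (k - 2)"
    using assms(2) by simp
  have "(fps_const (1 / 2) * fps_X ^ 2 * fps_deriv B_series) $ k
      = (of_nat k - 1) / 2 * u (k - 1)"
    using assms(2) by (simp add: mult.assoc fps_X_power_mult_nth u_def idx of_nat_diff)
  moreover have X_nth: "(fps_X :: 'a fps) $ k = 0"
    using assms(2) by simp
  moreover have "(B_series * fps_deriv B_series) $ k
      + (fps_const (1 / 2) * fps_X ^ 2 * fps_deriv B_series) $ k = (fps_X :: 'a fps) $ k"
    using B_series_ode by (metis fps_add_nth)
  moreover have "(B_series * fps_deriv B_series) $ k = (of_nat k + 1) * u k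
      + (\<Sum>j = 1..k - 2. (of_nat j + 1) * u (j + 1) * u (k - j))"
    unfolding u_def using assms(2)
    by (intro mult_deriv_nth) (simp_all only: B_series_nth_0 B_series_nth_1)
  ultimately have "(of_nat k + 1) * u k = - ((of_nat k - 1) / 2 * u (k - 1)
      + (\<Sum>j = 1..k - 2. (of_nat j + 1) * u (j + 1) * u (k - j)))"
    by (simp only: eq_neg_iff_add_eq_0 X_nth add_ac)
  moreover have "u k = 1 / (of_nat k + 1) * ((of_nat k + 1) * u k)"
    using nz by simp
  ultimately show ?thesis
    by (simp only: mult_minus_left mult_minus_right)
qed

lemma C_series_nth_rec:
  fixes k :: nat
  defines "u \<equiv> \<lambda>k. (C_series :: 'a::field_char_0 fps) $ k"
  assumes "k \<ge> 2"
  shows "u k = 1 / (of_nat k + 1) * (u (k - 1)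
    - (\<Sum>j = 1..k - 2. (of_nat j + 1) * u (j + 1) * u (k - j)))"
proof -
  have nz: "of_nat k + 1 \<noteq> (0 :: 'a)"
    by (metis of_nat_Suc of_nat_neq_0 add.commute)
  have "(C_series * fps_deriv C_series) $ k = u (k - 1)"
    using assms(2) by (simp add: C_series_ode u_def)
  moreover have "(C_series * fps_deriv C_series) $ k = (of_nat k + 1) * u k
      + (\<Sum>j = 1..k - 2. (of_nat j + 1) * u (j + 1) * u (k - j))"
    unfolding u_def using assms(2)
    by (intro mult_deriv_nth) (simp_all only: C_series_nth_0 C_series_nth_1)
  ultimately have "(of_nat k + 1) * u k
      = u (k - 1) - (\<Sum>j = 1..k - 2. (of_nat j + 1) * u (j + 1) * u (k - j))"
    by (simp add: algebra_simps)
  moreover have "u k = 1 / (of_nat k + 1) * ((of_nat k + 1) * u k)"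
    using nz by simp
  ultimately show ?thesis
    by (simp only: mult_minus_left mult_minus_right)
qed

text \<open>
  The sum for $\tilde a_k = a_k/k!$ turns into the one for $a_k$, because
  $(j+1)\,\tilde a_{j+1} = a_{j+1}/j!$.
\<close>

lemma fact_mult_sum_eq_binomial_sum:
  fixes a :: "nat \<Rightarrow> 'a::field_char_0"
  shows "fact k * (\<Sum>j = 1..k - 2. (of_nat j + 1) * (a (j + 1) / fact (j + 1)) * (a (k - j) / fact (k - j)))
    = (\<Sum>j = 1..k - 2. of_nat (k choose j) * a (j + 1) * a (k - j))"
  unfolding sum_distrib_left
proof (rule sum.cong [OF refl])
  fix j assume "j \<in> {1..k - 2}"
  then have "of_nat (k choose j) = (fact k / (fact j * fact (k - j)) :: 'a)"
    by (intro binomial_fact) auto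
  moreover have "(of_nat j + 1) * (a (j + 1) / fact (j + 1)) = a (j + 1) / fact j"
  proof -
    have "of_nat j + 1 \<noteq> (0 :: 'a)"
      by (metis of_nat_Suc of_nat_neq_0 add.commute)
    then show ?thesis
      by (simp add: divide_simps fact_Suc add.commute del: of_nat_Suc) (simp add: add.commute)
  qed
  ultimately show "fact k * ((of_nat j + 1) * (a (j + 1) / fact (j + 1)) * (a (k - j) / fact (k - j)))
      = of_nat (k choose j) * a (j + 1) * a (k - j)"
    by simp
qed

theorem proposition3p3:
  fixes b c bt ct :: "nat \<Rightarrow> 'a::field_char_0"
  assumes "B_series = egf1 b"
    and "C_series = egf1 c"
    and "\<And>k. k \<ge> 1 \<Longrightarrow> bt k = b k / fact k"
    and "\<And>k. k \<ge> 1 \<Longrightarrow> ct k = c k / fact k"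
  shows "b 1 = 1 \<and> c 1 = 1 \<and> bt 1 = 1 \<and> ct 1 = 1 \<and>
    (\<forall>k\<ge>2.
      b k = - (1 / (of_nat k + 1)) *
        (of_nat (k choose 2) * b (k - 1) +
          (\<Sum>j = 1..k - 2. of_nat (k choose j) * b (j + 1) * b (k - j))) \<and>
      bt k = - (1 / (of_nat k + 1)) *
        ((of_nat k - 1) / 2 * bt (k - 1) +
          (\<Sum>j = 1..k - 2. (of_nat j + 1) * bt (j + 1) * bt (k - j))) \<and>
      c k = 1 / (of_nat k + 1) *
        (of_nat k * c (k - 1) -
          (\<Sum>j = 1..k - 2. of_nat (k choose j) * c (j + 1) * c (k - j))) \<and>
      ct k = 1 / (of_nat k + 1) *
        (ct (k - 1) -
          (\<Sum>j = 1..k - 2. (of_nat j + 1) * ct (j + 1) * ct (k - j))))"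
proof -
  have Bn: "B_series $ k = bt k" and Cn: "C_series $ k = ct k" if "k \<ge> 1" for k
    using that assms(3,4) unfolding assms(1,2) by (simp_all add: egf1_def)
  have b: "b k = fact k * bt k" and c: "c k = fact k * ct k" if "k \<ge> 1" for k
    using that assms(3,4) by simp_all
  have bt1: "bt 1 = 1" and ct1: "ct 1 = 1"
    using Bn [of 1] Cn [of 1] B_series_nth_1 C_series_nth_1 by (metis order_refl)+
  have rec: "b k = - (1 / (of_nat k + 1)) *
        (of_nat (k choose 2) * b (k - 1) +
          (\<Sum>j = 1..k - 2. of_nat (k choose j) * b (j + 1) * b (k - j)))" (is ?b)
      "bt k = - (1 / (of_nat k + 1)) *
        ((of_nat k - 1) / 2 * bt (k - 1) +
          (\<Sum>j = 1..k - 2. (of_nat j + 1) * bt (j + 1) * bt (k - j)))" (is ?bt)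
      "c k = 1 / (of_nat k + 1) *
        (of_nat k * c (k - 1) -
          (\<Sum>j = 1..k - 2. of_nat (k choose j) * c (j + 1) * c (k - j)))" (is ?c)
      "ct k = 1 / (of_nat k + 1) *
        (ct (k - 1) -
          (\<Sum>j = 1..k - 2. (of_nat j + 1) * ct (j + 1) * ct (k - j)))" (is ?ct)
    if k: "k \<ge> 2" for k
  proof -
    have "(\<Sum>j = 1..k - 2. (of_nat j + 1) * (B_series :: 'a fps) $ (j + 1) * B_series $ (k - j))
        = (\<Sum>j = 1..k - 2. (of_nat j + 1) * bt (j + 1) * bt (k - j))"
      using k by (intro sum.cong) (auto simp: Bn)
    then show bt: ?bt
      using B_series_nth_rec [OF k, where 'a = 'a] k by (simp add: Bn)
    have "(\<Sum>j = 1..k - 2. (of_nat j + 1) * (C_series :: 'a fps) $ (j + 1) * C_series $ (k - j))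
        = (\<Sum>j = 1..k - 2. (of_nat j + 1) * ct (j + 1) * ct (k - j))"
      using k by (intro sum.cong) (auto simp: Cn)
    then show ct: ?ct
      using C_series_nth_rec [OF k, where 'a = 'a] k by (simp add: Cn)
    have scale_add: "fact k * x = d * (fact k * y + fact k * z)"
      if "x = d * (y + z)" for d x y z :: 'a
      using that by (simp add: distrib_left mult.left_commute)
    have scale_diff: "fact k * x = d * (fact k * y - fact k * z)"
      if "x = d * (y - z)" for d x y z :: 'a
      using that by (simp add: right_diff_distrib mult.left_commute)
    have fact_k: "fact k = of_nat k * (fact (k - 1) :: 'a)"
      using k by (intro fact_reduce) simp
    have choose_2: "of_nat (k choose 2) = of_nat k * (of_nat k - 1) / (2 :: 'a)"
      using k by (simp add: binomial_gbinomial gbinomial_pochhammer' numeral_2_eq_2 pochhammer_Suc)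
    have sum_b: "fact k * (\<Sum>j = 1..k - 2. (of_nat j + 1) * bt (j + 1) * bt (k - j))
        = (\<Sum>j = 1..k - 2. of_nat (k choose j) * b (j + 1) * b (k - j))"
      unfolding fact_mult_sum_eq_binomial_sum [symmetric]
      by (intro arg_cong2 [where f = "(*)"] sum.cong) (auto simp: assms(3))
    have sum_c: "fact k * (\<Sum>j = 1..k - 2. (of_nat j + 1) * ct (j + 1) * ct (k - j))
        = (\<Sum>j = 1..k - 2. of_nat (k choose j) * c (j + 1) * c (k - j))"
      unfolding fact_mult_sum_eq_binomial_sum [symmetric]
      by (intro arg_cong2 [where f = "(*)"] sum.cong) (auto simp: assms(4))
    have "fact k * ((of_nat k - 1) / 2 * bt (k - 1)) = of_nat (k choose 2) * b (k - 1)"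
      using k by (simp add: b choose_2 fact_k)
    moreover have "b k = fact k * bt k"
      using k by (simp add: b)
    ultimately show ?b
      by (simp only: scale_add [OF bt] sum_b)
    have "fact k * ct (k - 1) = of_nat k * c (k - 1)"
      using k by (simp add: c fact_k)
    moreover have "c k = fact k * ct k"
      using k by (simp add: c)
    ultimately show ?c
      by (simp only: scale_diff [OF ct] sum_c)
  qed
  show ?thesis
    using bt1 ct1 b [of 1] c [of 1] rec by simp
qed

end
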